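(* Let $\varepsilon,\mu,\sigma$ be bounded, strictly positive real scalar fields on $\Omega$, let $\varepsilon_c(\mathbf{x})=\varepsilon(\mathbf{x})+i\sigma(\mathbf{x})/\omega=|\varepsilon_c(\mathbf{x})|e^{i\varphi_\varepsilon(\mathbf{x})}$ with $\varphi_\varepsilon(\mathbf{x})\in\,]0,\pi/2[$, and let $\alpha(\mathbf{x})=|\alpha(\mathbf{x})|e^{i\varphi_\alpha(\mathbf{x})}$, $\varphi_\alpha(\mathbf{x})\in\mathbb{R}$, be a bounded complex scalar field on $\Gamma$, where $\varepsilon_c$, $\mu$ and $\alpha$ are elliptic. Consider the sesquilinear form of the Robin problem $$a^+(\mathbf{u},\mathbf{v})=(\mu^{-1}\,\mathbf{curl}\,\mathbf{u},\mathbf{curl}\,\mathbf{v})_\Omega-\omega^2(\varepsilon_c\mathbf{u},\mathbf{v})_\Omega-(\alpha\gamma^T\mathbf{u},\gamma^T\mathbf{v})_\Gamma$$ on $\mathbf{H}^+(\mathbf{curl},\Omega)$. If $\varphi_\varepsilon(\mathbf{x})\in[\varphi_{\varepsilon,-},\varphi_{\varepsilon,+}]$ a.e. in $\Omega$ and $\varphi_\alpha(\mathbf{x})\in[\varphi_{\alpha,-},\varphi_{\alpha,+}]$ a.e. on $\Gamma$ with $$0<\varphi_{\varepsilon,-}\le\varphi_{\varepsilon,+}<\pi/2,\qquad 0<\varphi_{\alpha,-}\le\varphi_{\alpha,+}<\pi+\varphi_{\varepsilon,-},\qquad \varphi_{\alpha,+}-\varphi_{\alpha,-}<\pi,$$ then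 $a^+$ is coercive for every coercivity direction $\theta_{\mathrm{coe}}\in\Theta_{\mathrm{coe}}:=\Theta_{\varepsilon_c}\cap\Theta_{-\mu^{-1}}\cap\Theta_\alpha$, and $$\Theta_{\mathrm{coe}}\supseteq\,\big]-\pi/2-\min(\varphi_{\varepsilon,-},\varphi_{\alpha,-}),\ -\pi/2-\max(0,\varphi_{\alpha,+}-\pi)\big[.$$ In addition, the equality holds if $\varphi_{\varepsilon,-}=\operatorname{ess\,inf}_{\Omega}\varphi_\varepsilon$, $\varphi_{\alpha,-}=\operatorname{ess\,inf}_{\Gamma}\varphi_\alpha$ and $\varphi_{\alpha,+}=\operatorname{ess\,sup}_{\Gamma}\varphi_\alpha$.
   Context: $\Omega\subset\mathbb{R}^3$ is an open, connected, bounded set with Lipschitz boundary $\Gamma$ and unit outward normal $\mathbf{n}$; $\omega>0$ is a real constant. $(\mathbf{a},\mathbf{b})_\Omega=\int_\Omega\mathbf{a}\cdot\overline{\mathbf{b}}\,d\mathbf{x}$, $(\mathbf{a},\mathbf{b})_\Gamma=\int_\Gamma\mathbf{a}\cdot\overline{\mathbf{b}}\,ds$, $\gamma^T\mathbf{v}=(\mathbf{v}\times\mathbf{n})|_\Gamma$. $\mathbf{L}^2_t(\Gamma)=\{\mathbf{v}\in\mathbf{L}^2(\Gamma):\mathbf{v}\cdot\mathbf{n}=0\text{ a.e.}\}$. $\mathbf{H}^+(\mathbf{curl},\Omega)=\{\mathbf{v}\in\mathbf{L}^2(\Omega):\mathbf{curl}\,\mathbf{v}\in\mathbf{L}^2(\Omega),\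 \gamma^T\mathbf{v}\in\mathbf{L}^2_t(\Gamma)\}$ (complex-valued fields) with norm $\|\mathbf{v}\|^2_{\mathbf{H}^+(\mathbf{curl},\Omega)}=\|\mathbf{v}\|^2_{\mathbf{L}^2(\Omega)}+\|\mathbf{curl}\,\mathbf{v}\|^2_{\mathbf{L}^2(\Omega)}+\|\gamma^T\mathbf{v}\|^2_{\mathbf{L}^2(\Gamma)}$. A complex scalar field $\xi\in L^\infty(D)$ ($D=\Omega$ with Lebesgue measure or $D=\Gamma$ with surface measure) is elliptic if there exist $\theta\in\mathbb{R}$ and $\xi_->0$ with $\mathrm{Re}\{e^{i\theta}\xi(\mathbf{x})\}\ge\xi_-$ a.e. in $D$; such a $\theta$ is an ellipticity direction and $\Theta_\xi$ is the set of all ellipticity directions in $[-\pi,\pi]$. (For the fields here, given the bounds on the phases, ellipticity amounts to $\operatorname{ess\,inf}\mu>0$, $\operatorname{ess\,inf}|\varepsilon_c|>0$, $\operatorname{ess\,inf}|\alpha|>0$.) A sesquilinear form $a$ on a Hilbert space $V$ is coercive for the direction $\theta_{\mathrm{coe}}\in\mathbb{R}$ if there exists $C_{\mathrm{coe}}>0$ such that $\mathrm{Re}\{-e^{i\theta_{\mathrm{coe}}}a(\mathbf{u},\mathbf{u})\}\ge C_{\mathrm{coe}}\|\mathbf{u}\|_V^2$ for all $\mathbf{u}\in V$. *)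

theory Defs
  imports "HOL-Analysis.Analysis" "HOL-Probability.Essential_Supremum"
begin

section \<open>Lipschitz domains, surface measure and outward normal\<close>

text \<open>Near every boundary point, in suitable Cartesian coordinates \<open>T\<close>, the set is the part of
  space strictly below the graph of a Lipschitz function. As \<open>U\<close> is open, this forces
  \<open>frontier \<Omega> \<inter> U\<close> to be the graph itself.\<close>

definition lipschitz_boundary :: "(real^3) set \<Rightarrow> bool" where
  "lipschitz_boundary \<Omega> \<longleftrightarrow>
    (\<forall>x\<in>frontier \<Omega>. \<exists>(T :: real^3 \<Rightarrow> real^3) U (h :: real^2 \<Rightarrow> real) L.
       orthogonal_transformation T \<and> open U \<and> x \<in> U \<and> L-lipschitz_on UNIV h \<and>
       (\<forall>y\<in>U. y \<in> \<Omega> \<longleftrightarrow> T y $ 3 < h (vector [T y $ 1, T y $ 2])))"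

text \<open>Surface measure is the two-dimensional Hausdorff measure. The factor \<open>pi / 4\<close> is the area of
  a disc of diameter 1, so that flat pieces get their area. Boundedness of the covering sets is
  explicit because \<open>diameter\<close> is a junk value on unbounded sets.\<close>

definition hausdorff2_pre :: "real \<Rightarrow> (real^3) set \<Rightarrow> ennreal" where
  "hausdorff2_pre \<delta> A =
    (INF E \<in> {E :: nat \<Rightarrow> (real^3) set. A \<subseteq> (\<Union>i. E i) \<and> (\<forall>i. bounded (E i) \<and> diameter (E i) \<le> \<delta>)}.
       \<Sum>i. ennreal (pi / 4 * (diameter (E i))\<^sup>2))"

definition hausdorff2 :: "(real^3) set \<Rightarrow> ennreal" where
  "hausdorff2 A = (SUP \<delta> \<in> {0<..}. hausdorff2_pre \<delta> A)"

text \<open>The measurable sets are the Caratheodory-measurable ones; this makes the measure complete.\<close>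

definition surface_measure :: "(real^3) set \<Rightarrow> (real^3) measure" where
  "surface_measure \<Gamma> = measure_of \<Gamma> (lambda_system \<Gamma> (Pow \<Gamma>) hausdorff2) hausdorff2"

lemma hausdorff2_pre_mono: "A \<subseteq> B \<Longrightarrow> hausdorff2_pre \<delta> A \<le> hausdorff2_pre \<delta> B"
  unfolding hausdorff2_pre_def by (rule INF_superset_mono) auto

lemma hausdorff2_mono: "A \<subseteq> B \<Longrightarrow> hausdorff2 A \<le> hausdorff2 B"
  unfolding hausdorff2_def by (intro SUP_mono') (rule hausdorff2_pre_mono)

lemma hausdorff2_empty: "hausdorff2 {} = 0"
proof -
  have "hausdorff2_pre \<delta> {} \<le> 0" if "\<delta> > 0" for \<delta>
    unfolding hausdorff2_pre_def
    by (rule INF_lower2[of "\<lambda>_. {}"]) (use that in auto)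
  then show ?thesis
    unfolding hausdorff2_def by (simp add: SUP_eq_const)
qed

lemma hausdorff2_pre_close:
  assumes "hausdorff2_pre \<delta> A < e"
  obtains E :: "nat \<Rightarrow> (real^3) set"
  where "A \<subseteq> (\<Union>i. E i)" "\<And>i. bounded (E i) \<and> diameter (E i) \<le> \<delta>"
    "(\<Sum>i. ennreal (pi / 4 * (diameter (E i))\<^sup>2)) < e"
  using assms unfolding hausdorff2_pre_def INF_less_iff by auto

lemma hausdorff2_pre_subadditive:
  fixes A :: "nat \<Rightarrow> (real^3) set"
  shows "hausdorff2_pre \<delta> (\<Union>n. A n) \<le> (\<Sum>n. hausdorff2_pre \<delta> (A n))"
proof (rule ennreal_le_epsilon)
  fix e :: real
  assume e: "0 < e" and fin: "(\<Sum>n. hausdorff2_pre \<delta> (A n)) < top"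
  let ?g = "\<lambda>S :: (real^3) set. ennreal (pi / 4 * (diameter S)\<^sup>2)"
  have lt: "hausdorff2_pre \<delta> (A n) < hausdorff2_pre \<delta> (A n) + e * (1/2) ^ Suc n" for n
    using e fin by (auto simp add: less_top dest!: ennreal_suminf_lessD)
  have "\<exists>E. A n \<subseteq> (\<Union>i. E i) \<and> (\<forall>i. bounded (E i) \<and> diameter (E i) \<le> \<delta>)
      \<and> (\<Sum>i. ?g (E i)) \<le> hausdorff2_pre \<delta> (A n) + e * (1/2) ^ Suc n" for n
  proof -
    obtain E :: "nat \<Rightarrow> (real^3) set"
      where E: "A n \<subseteq> (\<Union>i. E i)" "\<And>i. bounded (E i) \<and> diameter (E i) \<le> \<delta>"
        "(\<Sum>i. ?g (E i)) < hausdorff2_pre \<delta> (A n) + e * (1/2) ^ Suc n"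
      using hausdorff2_pre_close[OF lt[of n]] by blast
    then show ?thesis
      using E(1,2) less_imp_le[OF E(3)] by blast
  qed
  then have "\<forall>n. \<exists>E. A n \<subseteq> (\<Union>i. E i) \<and> (\<forall>i. bounded (E i) \<and> diameter (E i) \<le> \<delta>)
      \<and> (\<Sum>i. ?g (E i)) \<le> hausdorff2_pre \<delta> (A n) + e * (1/2) ^ Suc n" ..
  from choice[OF this] obtain B :: "nat \<Rightarrow> nat \<Rightarrow> (real^3) set"
    where cov: "\<And>n. A n \<subseteq> (\<Union>i. B n i)"
      and bd: "\<And>n i. bounded (B n i) \<and> diameter (B n i) \<le> \<delta>"
      and le: "\<And>n. (\<Sum>i. ?g (B n i)) \<le> hausdorff2_pre \<delta> (A n) + e * (1/2) ^ Suc n"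
    by blast
  define C where "C = case_prod B o prod_decode"
  have "(\<Union>n. A n) \<subseteq> (\<Union>i. C i)"
    using cov by (auto simp add: C_def subset_eq) (metis prod.case prod_encode_inverse)
  then have "hausdorff2_pre \<delta> (\<Union>n. A n) \<le> (\<Sum>i. ?g (C i))"
    unfolding hausdorff2_pre_def
    by (intro INF_lower) (use bd in \<open>auto simp: C_def split_def\<close>)
  also have "\<dots> = (\<Sum>n. \<Sum>i. ?g (B n i))"
    unfolding C_def comp_def by (intro suminf_ennreal_2dimen) auto
  also have "\<dots> \<le> (\<Sum>n. hausdorff2_pre \<delta> (A n) + e * (1/2) ^ Suc n)"
    by (intro suminf_le allI le) auto
  also have "\<dots> = (\<Sum>n. hausdorff2_pre \<delta> (A n)) + (\<Sum>n. ennreal e * ennreal ((1/2) ^ Suc n))"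
    using e by (subst suminf_add[symmetric])
      (auto simp del: ennreal_suminf_cmult simp add: ennreal_mult[symmetric])
  also have "\<dots> = (\<Sum>n. hausdorff2_pre \<delta> (A n)) + e"
    unfolding ennreal_suminf_cmult
    by (subst suminf_ennreal_eq[OF zero_le_power power_half_series]) auto
  finally show "hausdorff2_pre \<delta> (\<Union>n. A n) \<le> (\<Sum>n. hausdorff2_pre \<delta> (A n)) + e" .
qed

lemma outer_measure_space_hausdorff2: "outer_measure_space (Pow \<Gamma>) hausdorff2"
  unfolding outer_measure_space_def
proof (intro conjI)
  show "positive (Pow \<Gamma>) hausdorff2"
    by (simp add: positive_def hausdorff2_empty)
  show "increasing (Pow \<Gamma>) hausdorff2"
    by (auto simp: increasing_def intro: hausdorff2_mono)
  have "hausdorff2 (\<Union>n. A n) \<le> (\<Sum>n. hausdorff2 (A n))" for A :: "nat \<Rightarrow> (real^3) set"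
    unfolding hausdorff2_def[of "\<Union>n. A n"]
  proof (rule SUP_least)
    fix \<delta> :: real assume "\<delta> \<in> {0<..}"
    then have "(\<Sum>n. hausdorff2_pre \<delta> (A n)) \<le> (\<Sum>n. hausdorff2 (A n))"
      unfolding hausdorff2_def by (intro suminf_le allI SUP_upper) auto
    with hausdorff2_pre_subadditive
    show "hausdorff2_pre \<delta> (\<Union>n. A n) \<le> (\<Sum>n. hausdorff2 (A n))"
      by (rule order_trans)
  qed
  then show "countably_subadditive (Pow \<Gamma>) hausdorff2"
    by (simp add: countably_subadditive_def)
qed

lemma measure_space_hausdorff2:
  "measure_space \<Gamma> (lambda_system \<Gamma> (Pow \<Gamma>) hausdorff2) hausdorff2"
  using sigma_algebra.caratheodory_lemma[OF sigma_algebra_Pow outer_measure_space_hausdorff2] .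

lemma space_surface_measure: "space (surface_measure \<Gamma>) = \<Gamma>"
  unfolding surface_measure_def
  by (rule space_measure_of) (auto dest: lambda_system_sets)

lemma sets_surface_measure: "sets (surface_measure \<Gamma>) = lambda_system \<Gamma> (Pow \<Gamma>) hausdorff2"
  unfolding surface_measure_def
  using measure_space_hausdorff2[of \<Gamma>]
  by (intro sigma_algebra.sets_measure_of_eq) (simp add: measure_space_def)

lemma emeasure_surface_measure:
  assumes "A \<in> sets (surface_measure \<Gamma>)"
  shows "emeasure (surface_measure \<Gamma>) A = hausdorff2 A"
proof -
  have "sigma_algebra \<Gamma> (lambda_system \<Gamma> (Pow \<Gamma>) hausdorff2)"
    "positive (lambda_system \<Gamma> (Pow \<Gamma>) hausdorff2) hausdorff2"
    "countably_additive (lambda_system \<Gamma> (Pow \<Gamma>) hausdorff2) hausdorff2"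
    using measure_space_hausdorff2[of \<Gamma>] by (simp_all add: measure_space_def)
  then show ?thesis
    unfolding surface_measure_def
    using assms unfolding sets_surface_measure by (rule emeasure_measure_of_sigma)
qed

text \<open>\<open>n\<close> is the outward unit normal at \<open>x\<close> if \<open>\<Omega>\<close> is tangent at \<open>x\<close> to the half-space
  \<open>{y. (y - x) \<bullet> n < 0}\<close>. On a Lipschitz boundary this holds for some \<open>n\<close> exactly at the points
  where the local graph is differentiable, hence almost everywhere by Rademacher's theorem;
  elsewhere \<open>outward_normal\<close> is an arbitrary vector.\<close>

definition is_outward_normal :: "(real^3) set \<Rightarrow> real^3 \<Rightarrow> real^3 \<Rightarrow> bool" where
  "is_outward_normal \<Omega> x n \<longleftrightarrow> norm n = 1 \<and>
    (\<forall>e>0. \<exists>d>0. \<forall>y. norm (y - x) < d \<longrightarrow>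
       ((y - x) \<bullet> n > e * norm (y - x) \<longrightarrow> y \<notin> \<Omega>) \<and>
       ((y - x) \<bullet> n < - e * norm (y - x) \<longrightarrow> y \<in> \<Omega>))"

definition outward_normal :: "(real^3) set \<Rightarrow> real^3 \<Rightarrow> real^3" where
  "outward_normal \<Omega> x = (THE n. is_outward_normal \<Omega> x n)"

lemma is_outward_normal_unique:
  assumes n: "is_outward_normal \<Omega> x n" and m: "is_outward_normal \<Omega> x m"
  shows "n = m"
proof (rule ccontr)
  assume ne: "n \<noteq> m"
  define w where "w = n - m"
  define a where "a = 1 - n \<bullet> m"
  have nn: "n \<bullet> n = 1" "m \<bullet> m = 1"
    using n m by (auto simp: is_outward_normal_def norm_eq_1)
  have w0: "norm w > 0" using ne by (simp add: w_def)
  have "w \<bullet> w = 2 * a"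
    by (simp add: w_def a_def inner_diff_left inner_diff_right nn inner_commute)
  moreover have "w \<bullet> w > 0" using w0 by simp
  ultimately have a0: "a > 0" by simp
  have wn: "w \<bullet> n = a" "w \<bullet> m = - a"
    by (simp_all add: w_def a_def inner_diff_left nn inner_commute[of m n])
  define e where "e = a / (2 * norm w)"
  have e0: "e > 0" using a0 w0 by (simp add: e_def)
  obtain d1 where d1: "d1 > 0" "\<And>y. norm (y - x) < d1 \<Longrightarrow> (y - x) \<bullet> n > e * norm (y - x) \<Longrightarrow> y \<notin> \<Omega>"
    using n e0 unfolding is_outward_normal_def by meson
  obtain d2 where d2: "d2 > 0" "\<And>y. norm (y - x) < d2 \<Longrightarrow> (y - x) \<bullet> m < - e * norm (y - x) \<Longrightarrow> y \<in> \<Omega>"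
    using m e0 unfolding is_outward_normal_def by meson
  define t where "t = min d1 d2 / (2 * norm w)"
  have t0: "t > 0" using d1(1) d2(1) w0 by (simp add: t_def)
  have tn: "norm (t *\<^sub>R w) = min d1 d2 / 2"
    using d1(1) d2(1) w0 by (simp add: t_def)
  have lt: "norm ((x + t *\<^sub>R w) - x) < d1" "norm ((x + t *\<^sub>R w) - x) < d2"
    using tn d1(1) d2(1) by auto
  have en: "e * norm (t *\<^sub>R w) = t * a / 2"
    using t0 w0 by (simp add: e_def)
  have "((x + t *\<^sub>R w) - x) \<bullet> n > e * norm ((x + t *\<^sub>R w) - x)"
       "((x + t *\<^sub>R w) - x) \<bullet> m < - e * norm ((x + t *\<^sub>R w) - x)"
    using en wn t0 a0 by (simp_all add: algebra_simps)
  with d1(2)[OF lt(1)] d2(2)[OF lt(2)] show False by blast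
qed


section \<open>Function spaces\<close>

text \<open>Functions stand for their almost-everywhere classes; all notions below are insensitive to
  changes on null sets.\<close>

definition Linf :: "'a measure \<Rightarrow> ('a \<Rightarrow> 'b::real_normed_vector) set" where
  "Linf M = {f \<in> borel_measurable M. \<exists>C. AE x in M. norm (f x) \<le> C}"

definition L2 :: "'a measure \<Rightarrow> ('a \<Rightarrow> complex^3) set" where
  "L2 M = {f \<in> borel_measurable M. integrable M (\<lambda>x. (norm (f x))\<^sup>2)}"

definition L2_norm :: "'a measure \<Rightarrow> ('a \<Rightarrow> complex^3) \<Rightarrow> real" where
  "L2_norm M f = sqrt (LINT x|M. (norm (f x))\<^sup>2)"

definition L2_inner :: "'a measure \<Rightarrow> ('a \<Rightarrow> complex^3) \<Rightarrow> ('a \<Rightarrow> complex^3) \<Rightarrow> complex" where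
  "L2_inner M f g = (LINT x|M. (\<Sum>i\<in>UNIV. f x $ i * cnj (g x $ i)))"

text \<open>The notion \<open>esssup\<close> of the library lives in complete linear orders, hence \<open>ereal\<close>.\<close>

definition essinf :: "'a measure \<Rightarrow> ('a \<Rightarrow> ereal) \<Rightarrow> ereal" where
  "essinf M f = - esssup M (\<lambda>x. - f x)"

definition partial_deriv :: "3 \<Rightarrow> (real^3 \<Rightarrow> 'b::real_normed_vector) \<Rightarrow> real^3 \<Rightarrow> 'b" where
  "partial_deriv j f x = frechet_derivative f (at x) (axis j 1)"

primrec C_k :: "nat \<Rightarrow> (real^3 \<Rightarrow> 'b::real_normed_vector) \<Rightarrow> bool" where
  "C_k 0 f \<longleftrightarrow> continuous_on UNIV f"
| "C_k (Suc k) f \<longleftrightarrow> (\<forall>x. f differentiable at x) \<and> (\<forall>j. C_k k (partial_deriv j f))"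

definition smooth :: "(real^3 \<Rightarrow> 'b::real_normed_vector) \<Rightarrow> bool" where
  "smooth f \<longleftrightarrow> (\<forall>k. C_k k f)"

definition test_field :: "(real^3) set \<Rightarrow> (real^3 \<Rightarrow> complex^3) \<Rightarrow> bool" where
  "test_field \<Omega> \<phi> \<longleftrightarrow> smooth \<phi> \<and> (\<exists>K. compact K \<and> K \<subseteq> \<Omega> \<and> (\<forall>x. x \<notin> K \<longrightarrow> \<phi> x = 0))"

definition classical_curl :: "(real^3 \<Rightarrow> complex^3) \<Rightarrow> real^3 \<Rightarrow> complex^3" where
  "classical_curl v x = vector
    [partial_deriv 2 v x $ 3 - partial_deriv 3 v x $ 2,
     partial_deriv 3 v x $ 1 - partial_deriv 1 v x $ 3,
     partial_deriv 1 v x $ 2 - partial_deriv 2 v x $ 1]"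

definition is_weak_curl :: "(real^3) set \<Rightarrow> (real^3 \<Rightarrow> complex^3) \<Rightarrow> (real^3 \<Rightarrow> complex^3) \<Rightarrow> bool" where
  "is_weak_curl \<Omega> v w \<longleftrightarrow> w \<in> L2 (lebesgue_on \<Omega>) \<and>
    (\<forall>\<phi>. test_field \<Omega> \<phi> \<longrightarrow>
       L2_inner (lebesgue_on \<Omega>) v (classical_curl \<phi>) = L2_inner (lebesgue_on \<Omega>) w \<phi>)"

definition curl :: "(real^3) set \<Rightarrow> (real^3 \<Rightarrow> complex^3) \<Rightarrow> real^3 \<Rightarrow> complex^3" where
  "curl \<Omega> v = (SOME w. is_weak_curl \<Omega> v w)"

definition Hcurl :: "(real^3) set \<Rightarrow> (real^3 \<Rightarrow> complex^3) set" where
  "Hcurl \<Omega> = {v \<in> L2 (lebesgue_on \<Omega>). \<exists>w. is_weak_curl \<Omega> v w}"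

definition cross_normal :: "complex^3 \<Rightarrow> real^3 \<Rightarrow> complex^3" where
  "cross_normal v n = vector
    [v $ 2 * of_real (n $ 3) - v $ 3 * of_real (n $ 2),
     v $ 3 * of_real (n $ 1) - v $ 1 * of_real (n $ 3),
     v $ 1 * of_real (n $ 2) - v $ 2 * of_real (n $ 1)]"

definition L2t :: "(real^3) set \<Rightarrow> (real^3 \<Rightarrow> complex^3) set" where
  "L2t \<Omega> = {g \<in> L2 (surface_measure (frontier \<Omega>)).
     AE x in surface_measure (frontier \<Omega>).
       (\<Sum>i\<in>UNIV. g x $ i * of_real (outward_normal \<Omega> x $ i)) = 0}"

text \<open>A field in \<open>H(curl)\<close> has no pointwise boundary values: its tangential trace is the extension
  of \<open>v \<mapsto> v \<times> n\<close> by continuity from smooth fields, which are dense, to \<open>H(curl)\<close>.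
  By Green's formula the traces converge as functionals on smooth fields on the boundary, so the
  trace is square integrable iff this limit is represented by some \<open>g\<close> in \<open>L2t \<Omega>\<close>, which is
  then unique up to null sets and independent of the approximating sequence.\<close>

definition is_tangential_trace ::
    "(real^3) set \<Rightarrow> (real^3 \<Rightarrow> complex^3) \<Rightarrow> (real^3 \<Rightarrow> complex^3) \<Rightarrow> bool" where
  "is_tangential_trace \<Omega> v g \<longleftrightarrow> g \<in> L2t \<Omega> \<and>
    (\<exists>\<phi> :: nat \<Rightarrow> real^3 \<Rightarrow> complex^3.
       (\<forall>k. smooth (\<phi> k)) \<and>
       (\<lambda>k. L2_norm (lebesgue_on \<Omega>) (\<lambda>x. \<phi> k x - v x)) \<longlonglongrightarrow> 0 \<and>
       (\<lambda>k. L2_norm (lebesgue_on \<Omega>) (\<lambda>x. classical_curl (\<phi> k) x - curl \<Omega> v x)) \<longlonglongrightarrow> 0 \<and>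
       (\<forall>\<psi>. smooth \<psi> \<longrightarrow>
          (\<lambda>k. L2_inner (surface_measure (frontier \<Omega>))
                 (\<lambda>x. cross_normal (\<phi> k x) (outward_normal \<Omega> x)) \<psi>)
          \<longlonglongrightarrow> L2_inner (surface_measure (frontier \<Omega>)) g \<psi>))"

definition tangential_trace :: "(real^3) set \<Rightarrow> (real^3 \<Rightarrow> complex^3) \<Rightarrow> real^3 \<Rightarrow> complex^3" where
  "tangential_trace \<Omega> v = (SOME g. is_tangential_trace \<Omega> v g)"

definition Hplus_curl :: "(real^3) set \<Rightarrow> (real^3 \<Rightarrow> complex^3) set" where
  "Hplus_curl \<Omega> = {v \<in> Hcurl \<Omega>. \<exists>g. is_tangential_trace \<Omega> v g}"

definition Hplus_curl_norm :: "(real^3) set \<Rightarrow> (real^3 \<Rightarrow> complex^3) \<Rightarrow> real" where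
  "Hplus_curl_norm \<Omega> v = sqrt
    ((L2_norm (lebesgue_on \<Omega>) v)\<^sup>2 + (L2_norm (lebesgue_on \<Omega>) (curl \<Omega> v))\<^sup>2
     + (L2_norm (surface_measure (frontier \<Omega>)) (tangential_trace \<Omega> v))\<^sup>2)"


section \<open>Ellipticity, coercivity and the Robin form\<close>

definition ellipticity_direction :: "'a measure \<Rightarrow> ('a \<Rightarrow> complex) \<Rightarrow> real \<Rightarrow> bool" where
  "ellipticity_direction M \<xi> \<theta> \<longleftrightarrow> (\<exists>c>0. AE x in M. Re (exp (\<i> * of_real \<theta>) * \<xi> x) \<ge> c)"

definition elliptic :: "'a measure \<Rightarrow> ('a \<Rightarrow> complex) \<Rightarrow> bool" where
  "elliptic M \<xi> \<longleftrightarrow> \<xi> \<in> Linf M \<and> (\<exists>\<theta>. ellipticity_direction M \<xi> \<theta>)"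

definition ellipticity_directions :: "'a measure \<Rightarrow> ('a \<Rightarrow> complex) \<Rightarrow> real set" where
  "ellipticity_directions M \<xi> = {\<theta> \<in> {-pi..pi}. ellipticity_direction M \<xi> \<theta>}"

definition coercive :: "'v set \<Rightarrow> ('v \<Rightarrow> real) \<Rightarrow> ('v \<Rightarrow> 'v \<Rightarrow> complex) \<Rightarrow> real \<Rightarrow> bool" where
  "coercive V nrm a \<theta> \<longleftrightarrow>
    (\<exists>C>0. \<forall>u\<in>V. Re (- exp (\<i> * of_real \<theta>) * a u u) \<ge> C * (nrm u)\<^sup>2)"

definition complex_permittivity ::
    "real \<Rightarrow> (real^3 \<Rightarrow> real) \<Rightarrow> (real^3 \<Rightarrow> real) \<Rightarrow> real^3 \<Rightarrow> complex" where
  "complex_permittivity \<omega> \<epsilon> \<sigma> x = of_real (\<epsilon> x) + \<i> * of_real (\<sigma> x / \<omega>)"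

definition robin_form :: "(real^3) set \<Rightarrow> real \<Rightarrow> (real^3 \<Rightarrow> complex) \<Rightarrow> (real^3 \<Rightarrow> real) \<Rightarrow>
    (real^3 \<Rightarrow> complex) \<Rightarrow> (real^3 \<Rightarrow> complex^3) \<Rightarrow> (real^3 \<Rightarrow> complex^3) \<Rightarrow> complex" where
  "robin_form \<Omega> \<omega> \<epsilon>c \<mu> \<alpha> u v =
    L2_inner (lebesgue_on \<Omega>) (\<lambda>x. of_real (inverse (\<mu> x)) *s curl \<Omega> u x) (curl \<Omega> v)
    - of_real (\<omega>\<^sup>2) * L2_inner (lebesgue_on \<Omega>) (\<lambda>x. \<epsilon>c x *s u x) v
    - L2_inner (surface_measure (frontier \<Omega>))
        (\<lambda>x. \<alpha> x *s tangential_trace \<Omega> u x) (tangential_trace \<Omega> v)"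

definition coercivity_directions :: "(real^3) set \<Rightarrow> (real^3 \<Rightarrow> complex) \<Rightarrow> (real^3 \<Rightarrow> real) \<Rightarrow>
    (real^3 \<Rightarrow> complex) \<Rightarrow> real set" where
  "coercivity_directions \<Omega> \<epsilon>c \<mu> \<alpha> =
    ellipticity_directions (lebesgue_on \<Omega>) \<epsilon>c
    \<inter> ellipticity_directions (lebesgue_on \<Omega>) (\<lambda>x. - of_real (inverse (\<mu> x)))
    \<inter> ellipticity_directions (surface_measure (frontier \<Omega>)) \<alpha>"

end

theory Submission
  imports Defs
begin

text \<open>Each of the three terms of \<open>-e\<^sup>i\<^sup>\<theta> a(u,u)\<close> is a weighted square norm whose weight has real part bounded
  below, so coercivity holds with the smallest of the three constants. A field with phase \<open>\<phi>\<close> is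
  elliptic in direction \<open>\<theta>\<close> iff \<open>\<theta> + \<phi>\<close> stays, modulo \<open>2\<pi>\<close>, in a compact part of \<open>]-\<pi>/2, \<pi>/2[\<close>. The
  weight \<open>-1/\<mu>\<close> excludes \<open>cos \<theta> \<ge> 0\<close>, and \<open>\<epsilon>\<^sub>c\<close> excludes \<open>]\<pi>/2, \<pi>]\<close>; for the remaining \<open>\<theta>\<close> in
  \<open>[-\<pi>, -\<pi>/2[\<close> no reduction modulo \<open>2\<pi>\<close> occurs, and the conditions become inequalities between
  \<open>\<theta>\<close> and the essential bounds of the phases.\<close>

section \<open>Weighted square norms in L2\<close>

lemma sum_scaled_mult_cnj:
  fixes v :: "complex^'n"
  shows "(\<Sum>i\<in>UNIV. (z *s v) $ i * cnj (v $ i)) = z * of_real ((norm v)\<^sup>2)"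
proof -
  have "(norm v)\<^sup>2 = (\<Sum>i\<in>UNIV. (cmod (v $ i))\<^sup>2)"
    by (simp add: norm_vec_def L2_set_def sum_nonneg)
  then show ?thesis
    by (simp add: sum_distrib_left mult.assoc complex_norm_square[symmetric]
        del: complex_norm_square of_real_power)
qed

text \<open>Pointwise the integrand is \<open>\<xi> x\<close> times the squared norm of
  \<open>f x\<close>, so a lower bound on the weight integrates. Boundedness of \<xi> makes this
  product integrable, which lets \<open>Re\<close> and the factor \<open>z\<close> pass through the
  integral.\<close>

lemma Re_L2_inner_scaled_ge:
  assumes f: "f \<in> L2 M" and \<xi>: "\<xi> \<in> Linf M"
    and ge: "AE x in M. c \<le> Re (z * \<xi> x)"
  shows "c * (L2_norm M f)\<^sup>2 \<le> Re (z * L2_inner M (\<lambda>x. \<xi> x *s f x) f)"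
proof -
  let ?g = "\<lambda>x. (norm (f x))\<^sup>2"
  have int: "integrable M ?g"
    using f by (simp add: L2_def)
  obtain C where C: "AE x in M. cmod (\<xi> x) \<le> C"
    using \<xi> by (auto simp: Linf_def)
  have [measurable]: "\<xi> \<in> borel_measurable M" "f \<in> borel_measurable M"
    using f \<xi> by (auto simp: L2_def Linf_def)
  have int2: "integrable M (\<lambda>x. \<xi> x * of_real (?g x))"
  proof (rule Bochner_Integration.integrable_bound)
    show "integrable M (\<lambda>x. C * ?g x)"
      using int by simp
    show "(\<lambda>x. \<xi> x * of_real (?g x)) \<in> borel_measurable M"
      by measurable
    show "AE x in M. norm (\<xi> x * of_real (?g x)) \<le> norm (C * ?g x)"
      using C
    proof eventually_elim
      case (elim x)
      have "norm (\<xi> x * of_real (?g x)) = cmod (\<xi> x) * ?g x"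
        by (simp add: norm_mult norm_power)
      also have "\<dots> \<le> C * ?g x"
        by (intro mult_right_mono elim) simp
      also have "\<dots> \<le> norm (C * ?g x)"
        by simp
      finally show ?case .
    qed
  qed
  have "c * (L2_norm M f)\<^sup>2 = (LINT x|M. c * ?g x)"
    by (simp add: L2_norm_def)
  also have "\<dots> \<le> (LINT x|M. Re (z * (\<xi> x * of_real (?g x))))"
  proof (rule integral_mono_AE)
    show "integrable M (\<lambda>x. c * ?g x)"
      using int by simp
    show "integrable M (\<lambda>x. Re (z * (\<xi> x * of_real (?g x))))"
      by (intro integrable_Re integrable_mult_right int2)
    show "AE x in M. c * ?g x \<le> Re (z * (\<xi> x * of_real (?g x)))"
      using ge
    proof eventually_elim
      case (elim x)
      have "c * ?g x \<le> Re (z * \<xi> x) * ?g x"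
        by (intro mult_right_mono elim) simp
      also have "\<dots> = Re ((z * \<xi> x) * of_real (?g x))"
        by (simp del: of_real_power)
      finally show ?case
        by (simp only: mult.assoc)
    qed
  qed
  also have "\<dots> = Re (z * (LINT x|M. \<xi> x * of_real (?g x)))"
    using int2 by (simp only: integral_Re integrable_mult_right integral_mult_right_zero)
  finally show ?thesis
    by (simp only: L2_inner_def sum_scaled_mult_cnj)
qed

section \<open>Ellipticity in terms of modulus and phase\<close>

lemma elliptic_imp_norm_bounded_below:
  assumes "elliptic M \<xi>"
  shows "\<exists>c>0. AE x in M. c \<le> cmod (\<xi> x)"
proof -
  obtain \<theta> c where c: "c > 0" "AE x in M. c \<le> Re (exp (\<i> * of_real \<theta>) * \<xi> x)"
    using assms by (auto simp: elliptic_def ellipticity_direction_def)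
  from c(2) have "AE x in M. c \<le> cmod (\<xi> x)"
  proof eventually_elim
    case (elim x)
    have "Re (exp (\<i> * of_real \<theta>) * \<xi> x) \<le> cmod (exp (\<i> * of_real \<theta>) * \<xi> x)"
      by (rule complex_Re_le_cmod)
    with elim show ?case
      by (simp add: norm_mult)
  qed
  with c(1) show ?thesis by blast
qed

lemma Re_exp_mult_polar:
  assumes "z = of_real (cmod z) * exp (\<i> * of_real p)"
  shows "Re (exp (\<i> * of_real \<theta>) * z) = cmod z * cos (\<theta> + p)"
proof -
  have "exp (\<i> * of_real \<theta>) * z = of_real (cmod z) * cis (\<theta> + p)"
    by (subst assms) (simp add: cis_conv_exp distrib_left exp_add mult_ac)
  then show ?thesis by simp
qed

lemma Re_exp_mult_minus_of_real:
  "Re (exp (\<i> * of_real \<theta>) * - of_real r) = - cos \<theta> * r"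
  by (simp add: Re_exp)

text \<open>The rotated real part is the modulus times cos(\<theta> + \<phi>). The modulus is
  bounded below because \<xi> is elliptic in some direction, possibly another one; the cosine
  because its argument stays in a compact part of ]-pi/2, pi/2[.\<close>

lemma ellipticity_direction_polarI:
  assumes ell: "elliptic M \<xi>"
    and polar: "AE x in M. \<xi> x = of_real (cmod (\<xi> x)) * exp (\<i> * of_real (\<phi> x))"
    and \<phi>: "AE x in M. \<phi> x \<in> {p..q}"
    and bounds: "- pi/2 < \<theta> + p" "\<theta> + q < pi/2" "p \<le> q"
  shows "ellipticity_direction M \<xi> \<theta>"
proof -
  obtain c where c: "c > 0" "AE x in M. c \<le> cmod (\<xi> x)"
    using elliptic_imp_norm_bounded_below[OF ell] by blast
  \<comment> \<open>The cosine increases up to 0 and decreases after it, so its minimum over the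
    interval of phases is attained at an end point.\<close>
  define d where "d = min (cos (\<theta> + p)) (cos (\<theta> + q))"
  have d: "d > 0"
    using bounds by (auto simp: d_def intro!: cos_gt_zero_pi)
  have d_le: "d \<le> cos (\<theta> + t)" if t: "t \<in> {p..q}" for t
  proof (cases "\<theta> + t \<ge> 0")
    case True
    then have "cos (\<theta> + q) \<le> cos (\<theta> + t)"
      using t bounds by (intro cos_monotone_0_pi_le) auto
    then show ?thesis by (simp add: d_def)
  next
    case False
    then have "cos (\<theta> + p) \<le> cos (\<theta> + t)"
      using t bounds by (intro cos_monotone_minus_pi_0') auto
    then show ?thesis by (simp add: d_def)
  qed
  have "AE x in M. c * d \<le> Re (exp (\<i> * of_real \<theta>) * \<xi> x)"
    using c(2) polar \<phi>
  proof eventually_elim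
    case (elim x)
    then show ?case
      using c(1) d d_le by (subst Re_exp_mult_polar[OF elim(2)]) (intro mult_mono, auto)
  qed
  then show ?thesis
    using c(1) d by (auto simp: ellipticity_direction_def intro!: exI[of _ "c * d"])
qed

text \<open>An upper bound on the modulus turns ellipticity into a positive lower bound on
  cos(\<theta> + \<phi>). Since \<open>range\<close> excludes shifts by 2 pi, \<open>arccos\<close>
  converts this into a bound on the angle itself. The gap \<open>b < pi/2\<close> is uniform, so it
  survives the passage to essential bounds.\<close>

lemma ellipticity_direction_polarD:
  assumes \<xi>: "\<xi> \<in> Linf M"
    and dir: "ellipticity_direction M \<xi> \<theta>"
    and polar: "AE x in M. \<xi> x = of_real (cmod (\<xi> x)) * exp (\<i> * of_real (\<phi> x))"
    and range: "AE x in M. \<bar>\<theta> + \<phi> x\<bar> \<le> pi"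
  shows "\<exists>b<pi/2. AE x in M. \<bar>\<theta> + \<phi> x\<bar> \<le> b"
proof -
  obtain c where c: "c > 0" "AE x in M. c \<le> Re (exp (\<i> * of_real \<theta>) * \<xi> x)"
    using dir by (auto simp: ellipticity_direction_def)
  obtain C where C: "AE x in M. cmod (\<xi> x) \<le> C"
    using \<xi> by (auto simp: Linf_def)
  \<comment> \<open>On a null space \<open>C\<close> may be smaller than \<open>c\<close> or even
    negative; the maximum ensures that c / D lies in ]0, 1], where \<open>arccos\<close> is
    monotone.\<close>
  define D where "D = max C c"
  have D: "D > 0" "C \<le> D" "c \<le> D"
    using c(1) by (auto simp: D_def)
  have "arccos (c / D) < arccos 0"
    using c(1) D by (intro arccos_less_arccos) auto
  then have lt: "arccos (c / D) < pi/2" by simp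
  have "AE x in M. \<bar>\<theta> + \<phi> x\<bar> \<le> arccos (c / D)"
    using c(2) C polar range
  proof eventually_elim
    case (elim x)
    have le: "c \<le> cmod (\<xi> x) * cos (\<theta> + \<phi> x)"
      using elim(1) Re_exp_mult_polar[OF elim(3)] by simp
    \<comment> \<open>The sign is needed first: replacing the modulus by the larger \<open>D\<close>
      keeps the inequality only if the cosine is nonnegative.\<close>
    have pos: "0 < cos (\<theta> + \<phi> x)"
    proof (rule ccontr)
      assume "\<not> ?thesis"
      then have "cmod (\<xi> x) * cos (\<theta> + \<phi> x) \<le> 0"
        by (intro mult_nonneg_nonpos) auto
      with le c(1) show False by simp
    qed
    have "cmod (\<xi> x) * cos (\<theta> + \<phi> x) \<le> D * cos (\<theta> + \<phi> x)"
      using elim(2) D pos by (intro mult_right_mono) auto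
    with le D(1) have "c / D \<le> cos (\<theta> + \<phi> x)"
      by (simp add: divide_le_eq mult.commute)
    then have "arccos (cos \<bar>\<theta> + \<phi> x\<bar>) \<le> arccos (c / D)"
      using c(1) D by (intro arccos_le_arccos) (auto intro: order_trans[of _ 0])
    then show ?case
      using elim(4) by (subst (asm) arccos_cos) auto
  qed
  with lt show ?thesis by blast
qed

section \<open>Essential bounds of the phases\<close>

text \<open>The junk value of \<open>esssup\<close> on non-measurable functions is \<open>\<infinity>\<close>.\<close>

lemma esssup_eq_ereal_measurable:
  assumes "esssup M f = ereal r"
  shows "f \<in> borel_measurable M"
  using assms by (auto simp: esssup_def top_ereal_def split: if_splits)

lemma ge_esssup_if_AE_le:
  assumes "ereal r = esssup M (\<lambda>x. ereal (f x))" and "AE x in M. f x \<le> k"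
  shows "r \<le> k"
proof -
  have "esssup M (\<lambda>x. ereal (f x)) \<le> ereal k"
    using assms by (intro esssup_I esssup_eq_ereal_measurable[OF assms(1)[symmetric]]) auto
  with assms(1)[symmetric] show ?thesis by simp
qed

lemma le_essinf_if_AE_ge:
  assumes "ereal r = essinf M (\<lambda>x. ereal (f x))" and "AE x in M. k \<le> f x"
  shows "k \<le> r"
proof -
  have "ereal (- r) = esssup M (\<lambda>x. ereal (- f x))"
    using arg_cong[OF assms(1), of uminus] by (simp add: essinf_def)
  then have "- r \<le> - k"
    by (rule ge_esssup_if_AE_le) (use assms(2) in auto)
  then show ?thesis by simp
qed

text \<open>On a null space every number is an almost-everywhere lower bound, so no real
  \<open>r\<close> could be the essential infimum. This supplies the nontriviality of the domain
  where the equality of direction sets needs it.\<close>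

lemma essinf_eq_ereal_not_AE_False:
  assumes "ereal r = essinf M (\<lambda>x. ereal (f x))"
  shows "\<not> (AE x in M. False)"
proof
  assume *: "AE x in M. False"
  have "AE x in M. r + 1 \<le> f x"
    using * by eventually_elim simp
  from le_essinf_if_AE_ge[OF assms this] show False by simp
qed

section \<open>Coercivity of the Robin form\<close>

lemma of_real_in_Linf_iff:
  "(\<lambda>x. of_real (f x) :: complex) \<in> Linf M \<longleftrightarrow> f \<in> Linf M"
  by (auto simp: Linf_def borel_measurable_complex_iff)

lemma inverse_in_Linf:
  fixes f :: "'a \<Rightarrow> real"
  assumes "f \<in> borel_measurable M" and c: "c > 0" "AE x in M. c \<le> \<bar>f x\<bar>"
  shows "(\<lambda>x. inverse (f x)) \<in> Linf M"
proof -
  have "AE x in M. norm (inverse (f x)) \<le> inverse c"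
    using c(2) by eventually_elim (use c(1) in \<open>auto intro!: le_imp_inverse_le\<close>)
  with assms(1) show ?thesis by (auto simp: Linf_def)
qed

text \<open>Together with the next lemma, this is all that the coercivity proof uses about the
  chosen curl and trace: any square integrable representatives would do.\<close>

lemma curl_in_L2:
  assumes "v \<in> Hcurl \<Omega>"
  shows "curl \<Omega> v \<in> L2 (lebesgue_on \<Omega>)"
  using assms someI_ex[of "is_weak_curl \<Omega> v"]
  by (auto simp: Hcurl_def curl_def is_weak_curl_def)

lemma tangential_trace_in_L2:
  assumes "v \<in> Hplus_curl \<Omega>"
  shows "tangential_trace \<Omega> v \<in> L2 (surface_measure (frontier \<Omega>))"
  using assms someI_ex[of "is_tangential_trace \<Omega> v"]
  by (auto simp: Hplus_curl_def tangential_trace_def is_tangential_trace_def L2t_def)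

text \<open>Multiplication by -exp(i \<theta>) gives the three terms of the form the weights
  \<epsilon>c, -1/\<mu> and \<alpha>, each rotated by exp(i \<theta>). These are the fields whose
  ellipticity directions are intersected, so no term has to compensate for another.\<close>

lemma coercive_robin_form:
  assumes "\<omega> > 0"
    and \<epsilon>c: "\<epsilon>c \<in> Linf (lebesgue_on \<Omega>)"
    and inv_\<mu>: "(\<lambda>x. inverse (\<mu> x)) \<in> Linf (lebesgue_on \<Omega>)"
    and \<alpha>: "\<alpha> \<in> Linf (surface_measure (frontier \<Omega>))"
    and \<theta>: "\<theta> \<in> coercivity_directions \<Omega> \<epsilon>c \<mu> \<alpha>"
  shows "coercive (Hplus_curl \<Omega>) (Hplus_curl_norm \<Omega>) (robin_form \<Omega> \<omega> \<epsilon>c \<mu> \<alpha>) \<theta>"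
proof -
  let ?M = "lebesgue_on \<Omega>" and ?S = "surface_measure (frontier \<Omega>)"
  let ?e = "exp (\<i> * of_real \<theta>)"
  obtain c1 c2 c3 where c: "c1 > 0" "c2 > 0" "c3 > 0"
    and c1: "AE x in ?M. c1 \<le> Re (?e * \<epsilon>c x)"
    and c2: "AE x in ?M. c2 \<le> Re (?e * - of_real (inverse (\<mu> x)))"
    and c3: "AE x in ?S. c3 \<le> Re (?e * \<alpha> x)"
    using \<theta>
    unfolding coercivity_directions_def ellipticity_directions_def ellipticity_direction_def
    by blast
  define C where "C = min (\<omega>\<^sup>2 * c1) (min c2 c3)"
  have C: "C \<le> \<omega>\<^sup>2 * c1" "C \<le> c2" "C \<le> c3"
    by (auto simp: C_def)
  show ?thesis
    unfolding coercive_def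
  proof (intro exI conjI ballI)
    show "C > 0"
      using c \<open>\<omega> > 0\<close> by (simp add: C_def)
    fix u assume u: "u \<in> Hplus_curl \<Omega>"
    then have uH: "u \<in> Hcurl \<Omega>" and uL: "u \<in> L2 ?M"
      by (auto simp: Hplus_curl_def Hcurl_def)
    let ?w = "curl \<Omega> u" and ?g = "tangential_trace \<Omega> u"
    let ?U = "L2_inner ?M (\<lambda>x. \<epsilon>c x *s u x) u"
    let ?W = "L2_inner ?M (\<lambda>x. of_real (inverse (\<mu> x)) *s ?w x) ?w"
    let ?G = "L2_inner ?S (\<lambda>x. \<alpha> x *s ?g x) ?g"
    have U: "c1 * (L2_norm ?M u)\<^sup>2 \<le> Re (?e * ?U)"
      by (rule Re_L2_inner_scaled_ge[OF uL \<epsilon>c c1])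
    \<comment> \<open>The form contains 1/\<mu> while the direction is one for -1/\<mu>; the sign is
      moved into the multiplier \<open>z = - ?e\<close>.\<close>
    have "c2 * (L2_norm ?M ?w)\<^sup>2 \<le> Re ((- ?e) * ?W)"
      by (rule Re_L2_inner_scaled_ge[OF curl_in_L2[OF uH]])
        (use inv_\<mu> c2 in \<open>simp_all only: of_real_in_Linf_iff minus_mult_commute\<close>)
    then have W: "c2 * (L2_norm ?M ?w)\<^sup>2 \<le> - Re (?e * ?W)" by simp
    have G: "c3 * (L2_norm ?S ?g)\<^sup>2 \<le> Re (?e * ?G)"
      by (rule Re_L2_inner_scaled_ge[OF tangential_trace_in_L2[OF u] \<alpha> c3])
    have "C * (Hplus_curl_norm \<Omega> u)\<^sup>2
        = C * (L2_norm ?M u)\<^sup>2 + C * (L2_norm ?M ?w)\<^sup>2 + C * (L2_norm ?S ?g)\<^sup>2"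
      by (simp add: Hplus_curl_norm_def distrib_left)
    also have "\<dots> \<le> \<omega>\<^sup>2 * c1 * (L2_norm ?M u)\<^sup>2 + c2 * (L2_norm ?M ?w)\<^sup>2 + c3 * (L2_norm ?S ?g)\<^sup>2"
      by (intro add_mono mult_right_mono C) auto
    also have "\<dots> \<le> \<omega>\<^sup>2 * Re (?e * ?U) - Re (?e * ?W) + Re (?e * ?G)"
      using mult_left_mono[OF U, of "\<omega>\<^sup>2"] W G by (simp add: mult.assoc)
    also have "\<dots> = Re (of_real (\<omega>\<^sup>2) * (?e * ?U) - ?e * ?W + ?e * ?G)"
      by (simp del: of_real_power)
    also have "of_real (\<omega>\<^sup>2) * (?e * ?U) - ?e * ?W + ?e * ?G
        = - ?e * robin_form \<Omega> \<omega> \<epsilon>c \<mu> \<alpha> u u"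
      unfolding robin_form_def by (simp add: algebra_simps del: of_real_power)
    finally show "C * (Hplus_curl_norm \<Omega> u)\<^sup>2 \<le> Re (- ?e * robin_form \<Omega> \<omega> \<epsilon>c \<mu> \<alpha> u u)" .
  qed
qed

section \<open>Ellipticity directions of the weight -1/\<mu>\<close>

lemma ellipticity_direction_minus_inverse:
  assumes "\<mu> \<in> Linf M" and pos: "AE x in M. \<mu> x > 0" and cos: "cos \<theta> < 0"
  shows "ellipticity_direction M (\<lambda>x. - of_real (inverse (\<mu> x))) \<theta>"
proof -
  obtain C where C: "AE x in M. norm (\<mu> x) \<le> C"
    using assms(1) by (auto simp: Linf_def)
  \<comment> \<open>The rotated real part is -cos \<theta> / \<mu>, so an upper bound on \<mu>
    bounds it below. The maximum with 1 keeps this bound positive even if \<open>C\<close> is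
    not.\<close>
  define D where "D = max C 1"
  have D: "D > 0" "C \<le> D" by (auto simp: D_def)
  have "AE x in M. - cos \<theta> * inverse D \<le> Re (exp (\<i> * of_real \<theta>) * - of_real (inverse (\<mu> x)))"
    using C pos
  proof eventually_elim
    case (elim x)
    have "inverse D \<le> inverse (\<mu> x)"
      using elim D by (intro le_imp_inverse_le) auto
    then have "- cos \<theta> * inverse D \<le> - cos \<theta> * inverse (\<mu> x)"
      using cos by (intro mult_left_mono) auto
    then show ?case
      unfolding Re_exp_mult_minus_of_real .
  qed
  moreover have "- cos \<theta> * inverse D > 0"
    using cos D by (intro mult_pos_pos) auto
  ultimately show ?thesis
    unfolding ellipticity_direction_def by blast
qed

text \<open>If cos \<theta> were nonnegative, the rotated real part would be at most 0 wherever
  \<mu> is positive. This is a contradiction only at an existing point, hence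
  \<open>nonnull\<close>.\<close>

lemma ellipticity_direction_minus_inverseD:
  assumes dir: "ellipticity_direction M (\<lambda>x. - of_real (inverse (\<mu> x))) \<theta>"
    and pos: "AE x in M. \<mu> x > 0" and nonnull: "\<not> (AE x in M. False)"
  shows "cos \<theta> < 0"
proof (rule ccontr)
  assume cos: "\<not> ?thesis"
  obtain c where c: "c > 0" "AE x in M. c \<le> Re (exp (\<i> * of_real \<theta>) * - of_real (inverse (\<mu> x)))"
    using dir by (auto simp: ellipticity_direction_def)
  have "AE x in M. False"
    using c(2) pos
  proof eventually_elim
    case (elim x)
    have "0 \<le> cos \<theta> * inverse (\<mu> x)"
      using cos elim(2) by simp
    with elim(1) c(1) show ?case
      unfolding Re_exp_mult_minus_of_real by simp
  qed
  with nonnull show False ..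
qed

section \<open>Comparison of the direction set with the interval\<close>

theorem proposition5p2:
  fixes \<Omega> :: "(real^3) set"
    and \<omega> :: real
    and \<epsilon> \<mu> \<sigma> \<phi>\<epsilon> \<phi>\<alpha> :: "real^3 \<Rightarrow> real"
    and \<alpha> :: "real^3 \<Rightarrow> complex"
    and \<phi>\<epsilon>_minus \<phi>\<epsilon>_plus \<phi>\<alpha>_minus \<phi>\<alpha>_plus :: real
  assumes "open \<Omega>" and "connected \<Omega>" and "bounded \<Omega>" and "lipschitz_boundary \<Omega>"
    and "\<omega> > 0"
    and "\<epsilon> \<in> Linf (lebesgue_on \<Omega>)" and "AE x in lebesgue_on \<Omega>. \<epsilon> x > 0"
    and "\<mu> \<in> Linf (lebesgue_on \<Omega>)" and "AE x in lebesgue_on \<Omega>. \<mu> x > 0"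
    and "\<sigma> \<in> Linf (lebesgue_on \<Omega>)" and "AE x in lebesgue_on \<Omega>. \<sigma> x > 0"
    and "AE x in lebesgue_on \<Omega>. \<phi>\<epsilon> x \<in> {0<..<pi/2} \<and>
           complex_permittivity \<omega> \<epsilon> \<sigma> x
             = of_real (cmod (complex_permittivity \<omega> \<epsilon> \<sigma> x)) * exp (\<i> * of_real (\<phi>\<epsilon> x))"
    and "\<alpha> \<in> Linf (surface_measure (frontier \<Omega>))"
    and "AE x in surface_measure (frontier \<Omega>).
           \<alpha> x = of_real (cmod (\<alpha> x)) * exp (\<i> * of_real (\<phi>\<alpha> x))"
    and "elliptic (lebesgue_on \<Omega>) (complex_permittivity \<omega> \<epsilon> \<sigma>)"
    and "elliptic (lebesgue_on \<Omega>) (\<lambda>x. of_real (\<mu> x))"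
    and "elliptic (surface_measure (frontier \<Omega>)) \<alpha>"
    and "AE x in lebesgue_on \<Omega>. \<phi>\<epsilon> x \<in> {\<phi>\<epsilon>_minus..\<phi>\<epsilon>_plus}"
    and "AE x in surface_measure (frontier \<Omega>). \<phi>\<alpha> x \<in> {\<phi>\<alpha>_minus..\<phi>\<alpha>_plus}"
    and "0 < \<phi>\<epsilon>_minus" and "\<phi>\<epsilon>_minus \<le> \<phi>\<epsilon>_plus" and "\<phi>\<epsilon>_plus < pi/2"
    and "0 < \<phi>\<alpha>_minus" and "\<phi>\<alpha>_minus \<le> \<phi>\<alpha>_plus" and "\<phi>\<alpha>_plus < pi + \<phi>\<epsilon>_minus"
    and "\<phi>\<alpha>_plus - \<phi>\<alpha>_minus < pi"
  shows "(\<forall>\<theta> \<in> coercivity_directions \<Omega> (complex_permittivity \<omega> \<epsilon> \<sigma>) \<mu> \<alpha>.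
            coercive (Hplus_curl \<Omega>) (Hplus_curl_norm \<Omega>)
              (robin_form \<Omega> \<omega> (complex_permittivity \<omega> \<epsilon> \<sigma>) \<mu> \<alpha>) \<theta>)
       \<and> {- pi/2 - min \<phi>\<epsilon>_minus \<phi>\<alpha>_minus <..< - pi/2 - max 0 (\<phi>\<alpha>_plus - pi)}
           \<subseteq> coercivity_directions \<Omega> (complex_permittivity \<omega> \<epsilon> \<sigma>) \<mu> \<alpha>
       \<and> (ereal \<phi>\<epsilon>_minus = essinf (lebesgue_on \<Omega>) (\<lambda>x. ereal (\<phi>\<epsilon> x)) \<and>
          ereal \<phi>\<alpha>_minus = essinf (surface_measure (frontier \<Omega>)) (\<lambda>x. ereal (\<phi>\<alpha> x)) \<and>
          ereal \<phi>\<alpha>_plus = esssup (surface_measure (frontier \<Omega>)) (\<lambda>x. ereal (\<phi>\<alpha> x))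
          \<longrightarrow> coercivity_directions \<Omega> (complex_permittivity \<omega> \<epsilon> \<sigma>) \<mu> \<alpha>
              = {- pi/2 - min \<phi>\<epsilon>_minus \<phi>\<alpha>_minus <..< - pi/2 - max 0 (\<phi>\<alpha>_plus - pi)})"
proof -
  let ?M = "lebesgue_on \<Omega>" and ?S = "surface_measure (frontier \<Omega>)"
  let ?\<epsilon>c = "complex_permittivity \<omega> \<epsilon> \<sigma>"
  let ?I = "{- pi/2 - min \<phi>\<epsilon>_minus \<phi>\<alpha>_minus <..< - pi/2 - max 0 (\<phi>\<alpha>_plus - pi)}"
  let ?\<Theta> = "coercivity_directions \<Omega> ?\<epsilon>c \<mu> \<alpha>"
  note \<mu> = \<open>\<mu> \<in> Linf ?M\<close> \<open>AE x in ?M. \<mu> x > 0\<close>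
  note \<alpha> = \<open>\<alpha> \<in> Linf ?S\<close>
  note ell = \<open>elliptic ?M ?\<epsilon>c\<close> \<open>elliptic ?S \<alpha>\<close>
  note \<phi>\<epsilon> = \<open>AE x in ?M. \<phi>\<epsilon> x \<in> {\<phi>\<epsilon>_minus..\<phi>\<epsilon>_plus}\<close>
  note \<phi>\<alpha> = \<open>AE x in ?S. \<phi>\<alpha> x \<in> {\<phi>\<alpha>_minus..\<phi>\<alpha>_plus}\<close>
  note num = \<open>0 < \<phi>\<epsilon>_minus\<close> \<open>\<phi>\<epsilon>_minus \<le> \<phi>\<epsilon>_plus\<close> \<open>\<phi>\<epsilon>_plus < pi/2\<close>
    \<open>0 < \<phi>\<alpha>_minus\<close> \<open>\<phi>\<alpha>_minus \<le> \<phi>\<alpha>_plus\<close> \<open>\<phi>\<alpha>_plus < pi + \<phi>\<epsilon>_minus\<close>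
  have \<epsilon>c: "?\<epsilon>c \<in> Linf ?M"
    using ell(1) by (simp add: elliptic_def)
  have polar_\<epsilon>: "AE x in ?M. ?\<epsilon>c x = of_real (cmod (?\<epsilon>c x)) * exp (\<i> * of_real (\<phi>\<epsilon> x))"
    using assms(12) by eventually_elim blast
  note polar_\<alpha> = \<open>AE x in ?S. \<alpha> x = of_real (cmod (\<alpha> x)) * exp (\<i> * of_real (\<phi>\<alpha> x))\<close>
  \<comment> \<open>Positivity almost everywhere would not bound 1/\<mu>; ellipticity of \<mu>
    does.\<close>
  have inv_\<mu>: "(\<lambda>x. inverse (\<mu> x)) \<in> Linf ?M"
  proof -
    obtain c where "c > 0" "AE x in ?M. c \<le> cmod (of_real (\<mu> x))"
      using elliptic_imp_norm_bounded_below[OF \<open>elliptic ?M (\<lambda>x. of_real (\<mu> x))\<close>] by blast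
    with \<mu>(1) show ?thesis
      by (intro inverse_in_Linf[of _ _ c]) (auto simp: Linf_def)
  qed
  have coercive: "\<forall>\<theta>\<in>?\<Theta>. coercive (Hplus_curl \<Omega>) (Hplus_curl_norm \<Omega>) (robin_form \<Omega> \<omega> ?\<epsilon>c \<mu> \<alpha>) \<theta>"
    by (intro ballI coercive_robin_form \<open>\<omega> > 0\<close> \<epsilon>c inv_\<mu> \<alpha>)
  have interval_subset: "?I \<subseteq> ?\<Theta>"
  proof
    fix \<theta> assume "\<theta> \<in> ?I"
    \<comment> \<open>Splitting the minimum and the maximum gives the lower conditions for
      \<epsilon>c and \<alpha>, the condition for -1/\<mu>, and the upper condition for \<alpha>.
      The upper condition for \<epsilon>c follows from \<open>\<theta> < - pi/2\<close> and
      \<open>\<phi>\<epsilon>_plus < pi/2\<close>.\<close>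
    then have \<theta>: "- pi/2 < \<theta> + \<phi>\<epsilon>_minus" "- pi/2 < \<theta> + \<phi>\<alpha>_minus" "\<theta> < - pi/2" "\<theta> + \<phi>\<alpha>_plus < pi/2"
      by auto
    have range: "\<theta> \<in> {-pi..pi}"
      using \<theta> num by auto
    have "cos (\<theta> + pi) > 0"
      using \<theta> num by (intro cos_gt_zero_pi) auto
    then have "ellipticity_direction ?M (\<lambda>x. - of_real (inverse (\<mu> x))) \<theta>"
      by (intro ellipticity_direction_minus_inverse \<mu>) simp
    moreover have "ellipticity_direction ?M ?\<epsilon>c \<theta>"
      by (rule ellipticity_direction_polarI[OF ell(1) polar_\<epsilon> \<phi>\<epsilon>]) (use \<theta> num in auto)
    moreover have "ellipticity_direction ?S \<alpha> \<theta>"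
      by (rule ellipticity_direction_polarI[OF ell(2) polar_\<alpha> \<phi>\<alpha>]) (use \<theta> num in auto)
    ultimately show "\<theta> \<in> ?\<Theta>"
      using range by (simp add: coercivity_directions_def ellipticity_directions_def)
  qed
  have subset_interval: "?\<Theta> \<subseteq> ?I"
    if ess: "ereal \<phi>\<epsilon>_minus = essinf ?M (\<lambda>x. ereal (\<phi>\<epsilon> x))"
      "ereal \<phi>\<alpha>_minus = essinf ?S (\<lambda>x. ereal (\<phi>\<alpha> x))"
      "ereal \<phi>\<alpha>_plus = esssup ?S (\<lambda>x. ereal (\<phi>\<alpha> x))"
  proof
    fix \<theta> assume "\<theta> \<in> ?\<Theta>"
    then have dir_\<epsilon>: "ellipticity_direction ?M ?\<epsilon>c \<theta>"
      and dir_\<mu>: "ellipticity_direction ?M (\<lambda>x. - of_real (inverse (\<mu> x))) \<theta>"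
      and dir_\<alpha>: "ellipticity_direction ?S \<alpha> \<theta>"
      and range: "- pi \<le> \<theta>" "\<theta> \<le> pi"
      by (auto simp: coercivity_directions_def ellipticity_directions_def)
    note nonnull = essinf_eq_ereal_not_AE_False[OF ess(1)]
    have "cos \<theta> < 0"
      by (rule ellipticity_direction_minus_inverseD[OF dir_\<mu> \<mu>(2) nonnull])
    moreover have "0 \<le> cos \<theta>" if "- pi/2 \<le> \<theta>" "\<theta> \<le> pi/2"
      using that by (intro cos_ge_zero) auto
    ultimately have outside: "\<theta> < - pi/2 \<or> pi/2 < \<theta>"
      by linarith
    \<comment> \<open>For \<theta> in ]pi/2, pi] the sum of \<theta> and the phase of \<epsilon>c
      lies between pi/2 and 3 pi/2, where the cosine is not positive.\<close>
    have lower: "\<theta> < - pi/2"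
    proof (rule ccontr)
      assume "\<not> ?thesis"
      with outside have \<theta>: "pi/2 < \<theta>" by simp
      obtain c where c: "c > 0" "AE x in ?M. c \<le> Re (exp (\<i> * of_real \<theta>) * ?\<epsilon>c x)"
        using dir_\<epsilon> by (auto simp: ellipticity_direction_def)
      have "AE x in ?M. False"
        using c(2) polar_\<epsilon> \<phi>\<epsilon>
      proof eventually_elim
        case (elim x)
        have "0 \<le> cos (\<theta> + \<phi>\<epsilon> x - pi)"
          using \<theta> range elim(3) num by (intro cos_ge_zero) auto
        then have "cmod (?\<epsilon>c x) * cos (\<theta> + \<phi>\<epsilon> x) \<le> 0"
          by (intro mult_nonneg_nonpos) (auto simp: cos_diff)
        with elim(1) c(1) show ?case
          unfolding Re_exp_mult_polar[OF elim(2)] by simp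
      qed
      with nonnull show False ..
    qed
    have "AE x in ?M. \<bar>\<theta> + \<phi>\<epsilon> x\<bar> \<le> pi"
      using \<phi>\<epsilon> by eventually_elim (use range lower num in auto)
    then obtain b where b: "b < pi/2" "AE x in ?M. \<bar>\<theta> + \<phi>\<epsilon> x\<bar> \<le> b"
      using ellipticity_direction_polarD[OF \<epsilon>c dir_\<epsilon> polar_\<epsilon>] by blast
    have "AE x in ?M. - b - \<theta> \<le> \<phi>\<epsilon> x"
      using b(2) by eventually_elim auto
    then have 1: "- b - \<theta> \<le> \<phi>\<epsilon>_minus"
      by (rule le_essinf_if_AE_ge[OF ess(1)])
    \<comment> \<open>The upper half holds because \<theta> < -pi/2 and
      \<open>\<phi>\<alpha>_plus < pi + \<phi>\<epsilon>_minus\<close>, where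
      \<open>\<phi>\<epsilon>_minus < pi/2\<close>.\<close>
    have "AE x in ?S. \<bar>\<theta> + \<phi>\<alpha> x\<bar> \<le> pi"
      using \<phi>\<alpha> by eventually_elim (use range lower num in auto)
    then obtain d where d: "d < pi/2" "AE x in ?S. \<bar>\<theta> + \<phi>\<alpha> x\<bar> \<le> d"
      using ellipticity_direction_polarD[OF \<alpha> dir_\<alpha> polar_\<alpha>] by blast
    have "AE x in ?S. - d - \<theta> \<le> \<phi>\<alpha> x" "AE x in ?S. \<phi>\<alpha> x \<le> d - \<theta>"
      using d(2) by (eventually_elim, auto)+
    then have 2: "- d - \<theta> \<le> \<phi>\<alpha>_minus" "\<phi>\<alpha>_plus \<le> d - \<theta>"
      using le_essinf_if_AE_ge[OF ess(2)] ge_esssup_if_AE_le[OF ess(3)] by blast+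
    \<comment> \<open>The essential bounds give only weak inequalities; strictness at the ends of
      the interval comes from \<open>b < pi/2\<close>, \<open>d < pi/2\<close> and
      \<open>lower\<close>.\<close>
    show "\<theta> \<in> ?I"
      using 1 2 b(1) d(1) lower by auto
  qed
  show ?thesis
    using coercive interval_subset subset_interval by blast
qed

end
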